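(* Let $p$ be a prime and let $1\le a_1\le a_2\le a_3$ be integers. For every integer $b$ with $0\le b\le a_1+a_2+a_3$, the number $h_b^{(a_3,a_2,a_1)}(p)$ of all subgroups of order $p^b$ (equivalently, of index $p^{a_1+a_2+a_3-b}$) in the finite abelian $p$-group $\mathbb{Z}/p^{a_1}\times\mathbb{Z}/p^{a_2}\times\mathbb{Z}/p^{a_3}$ is given by one of the following polynomials in $p$, expressed as rational functions, according to the following cases. Case 1: if $0\le b\le a_1$, then $$h_b^{(a_3,a_2,a_1)}(p)=\frac{p^{2b+3}-p^{b+2}-p^{b+1}+1}{(p-1)(p^2-1)}.$$ Case 2: if $a_1\le b\le a_2$, then $$h_b^{(a_3,a_2,a_1)}(p)=\frac{p^{b+a_1+3}+p^{b+a_1+2}-p^{2a_1+2}-p^{b+2}-p^{b+1}+1}{(p-1)(p^2-1)}.$$ Case 3: if $a_2<b\le a_3\le a_1+a_2$, then $$h_b^{(a_3,a_2,a_1)}(p)=\frac{(b-a_2+1)p^{a_2+a_1+3}+p^{a_2+a_1+2}-(b-a_2)p^{a_1+a_2+1}-p^{2a_1+2}-p^{b+2}-p^{b+1}+1}{(p-1)(p^2-1)}.$$ Case 4: if $a_2<b\le a_1+a_2\le a_3$, then $$h_b^{(a_3,a_2,a_1)}(p)=\frac{(b-a_2+1)p^{a_2+a_1+3}+p^{a_2+a_1+2}-(b-a_2)p^{a_1+a_2+1}-p^{2a_1+2}-p^{b+2}-p^{b+1}+1}{(p-1)(p^2-1)}.$$ Case 5: if $a_1+a_2\le b\le a_3$,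 then $$h_b^{(a_3,a_2,a_1)}(p)=\frac{(a_1+1)p^{a_2+a_1+3}+p^{a_2+a_1+2}-a_1p^{a_1+a_2+1}-p^{2a_1+2}-p^{a_1+a_2+2}-p^{a_1+a_2+1}+1}{(p-1)(p^2-1)}.$$ Case 6: if $a_3<b\le a_1+a_2$, then $h_b^{(a_3,a_2,a_1)}(p)=\dfrac{A}{(p-1)(p^2-1)}$, where $$A=(a_3-a_2+1)p^{a_2+a_1+3}+2p^{a_2+a_1+2}-(a_3-a_2-1)p^{a_2+a_1+1}-p^{a_3+a_2+a_1-b+2}-p^{a_3+a_2+a_1-b+1}-p^{2a_1+2}-p^{b+2}-p^{b+1}+1.$$ (The remaining cases are obtained from the cases above by replacing $b$ by $a_1+a_2+a_3-b$.) Case 7: if $a_1+a_2<a_3<b\le a_1+a_3$, then $h_b^{(a_3,a_2,a_1)}(p)=\dfrac{B}{(p-1)(p^2-1)}$, where $$B=(a_1+a_3-b+1)p^{a_2+a_1+3}+p^{a_2+a_1+2}-(a_1+a_3-b)p^{a_1+a_2+1}-p^{2a_1+2}-p^{a_1+a_2+a_3-b+2}-p^{a_1+a_2+a_3-b+1}+1.$$ Case 8: if $a_3<a_1+a_2<b\le a_1+a_3$, then $h_b^{(a_3,a_2,a_1)}(p)=\dfrac{B}{(p-1)(p^2-1)}$ with the same expression $B$ as displayed in Case 7. Case 9: if $a_1+a_3\le b\le a_2+a_3$, then $$h_b^{(a_3,a_2,a_1)}(p)=\frac{p^{2a_1+a_2+a_3-b+3}+p^{2a_1+a_2+a_3-b+2}-p^{2a_1+2}-p^{a_1+a_2+a_3-b+2}-p^{a_1+a_2+a_3-b+1}+1}{(p-1)(p^2-1)}.$$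 Case 10: if $a_2+a_3\le b\le a_1+a_2+a_3$, then $$h_b^{(a_3,a_2,a_1)}(p)=\frac{p^{2a_1+2a_2+2a_3-2b+3}-p^{a_1+a_2+a_3-b+2}-p^{a_1+a_2+a_3-b+1}+1}{(p-1)(p^2-1)}.$$
   Context: $\mathbb{Z}/p^{a}$ denotes the cyclic group of order $p^a$. $h_b^{(a_3,a_2,a_1)}(p)$ denotes the number of subgroups of order $p^b$ in $\mathbb{Z}/p^{a_1}\times\mathbb{Z}/p^{a_2}\times\mathbb{Z}/p^{a_3}$; in a finite abelian group of order $p^n$ the number of subgroups of order $p^b$ equals the number of subgroups of index $p^b$ (i.e. of order $p^{n-b}$), so $h_b$ may be read either way. *)

theory Defs
  imports Complex_Main "HOL-Computational_Algebra.Primes" "HOL-Algebra.Elementary_Groups"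
begin

definition rank3_group :: "nat \<Rightarrow> nat \<Rightarrow> nat \<Rightarrow> nat \<Rightarrow> (int \<times> int \<times> int) monoid" where
  "rank3_group p a1 a2 a3 =
     integer_mod_group (p ^ a1) \<times>\<times> integer_mod_group (p ^ a2) \<times>\<times> integer_mod_group (p ^ a3)"

definition num_subgroups_of_order :: "('a, 'm) monoid_scheme \<Rightarrow> nat \<Rightarrow> nat" where
  "num_subgroups_of_order G k = card {H. subgroup H G \<and> card H = k}"

definition num_subgroups_of_index :: "('a, 'm) monoid_scheme \<Rightarrow> nat \<Rightarrow> nat" where
  "num_subgroups_of_index G k = card {H. subgroup H G \<and> card (rcosets\<^bsub>G\<^esub> H) = k}"

(* h_b^{(a3,a2,a1)}(p), with the superscript partition in the same (decreasing) order *)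
definition hsub :: "nat \<Rightarrow> nat \<Rightarrow> nat \<Rightarrow> nat \<Rightarrow> nat \<Rightarrow> nat" where
  "hsub a3 a2 a1 p b = num_subgroups_of_order (rank3_group p a1 a2 a3) (p ^ b)"

end

theory Submission
  imports Defs
begin

text \<open>
  Let \<open>h\<^sub>b(G)\<close> be the number of subgroups of order \<open>p\<^sup>b\<close> of \<open>G\<close>, and let \<open>A\<close> be a finite abelian group whose exponent
  divides \<open>p\<^sup>m\<close>, where \<open>m > 0\<close>. A subgroup of \<open>A \<times> \<int>/p\<^sup>m\<close> either lies in \<open>A \<times> p\<int>/p\<^sup>m\<close>, which is isomorphic to
  \<open>A \<times> \<int>/p\<^sup>m\<^sup>-\<^sup>1\<close>, or contains some \<open>(x, 1)\<close>. In the latter case it is determined by its intersection \<open>K\<close> with \<open>A\<close>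
  and by the coset \<open>xK\<close>, and any pair \<open>(K, x)\<close> occurs. Hence
  \<open>h\<^sub>b(A \<times> \<int>/p\<^sup>m) = h\<^sub>b(A \<times> \<int>/p\<^sup>m\<^sup>-\<^sup>1) + |A| h\<^sub>j(A) / p\<^sup>j\<close> with \<open>j = b - m\<close>.
  Always shrinking a largest cyclic factor, this recurrence gives the counts in ranks 1, 2 and 3; in rank 3 the
  piecewise closed form satisfies the same recurrence. Its symmetry under
  \<open>b \<mapsto> a\<^sub>1 + a\<^sub>2 + a\<^sub>3 - b\<close> is read off the closed form.
\<close>

section \<open>Subgroups of a product with a cyclic group\<close>

lemma (in group_hom) subgroup_preimage:
  assumes "subgroup K H"
  shows "subgroup {x \<in> carrier G. h x \<in> K} G"
proof -
  interpret K: subgroup K H by fact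
  show ?thesis by unfold_locales auto
qed

text \<open>Taking images and preimages under \<open>f\<close> matches the subgroups of
  \<open>G\<close> with those inside its image, and injectivity preserves their orders. Applied to
  \<open>incl\<close> it counts the subgroups that miss the generators of the cyclic factor; a
  surjective \<open>f\<close> gives invariance under isomorphism.\<close>

lemma card_subgroups_inj_hom:
  assumes "group G" "group H" "f \<in> hom G H" "inj_on f (carrier G)"
  shows "card {K. subgroup K H \<and> K \<subseteq> f ` carrier G \<and> card K = k} = num_subgroups_of_order G k"
proof -
  interpret group_hom G H f
    using assms by (simp add: group_hom_def group_hom_axioms_def)
  have card_image: "card (f ` K) = card K" if "subgroup K G" for K
    using assms(4) subgroup.subset[OF that] by (meson card_image inj_on_subset)
  have "bij_betw (image f) {K. subgroup K G \<and> card K = k}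
          {K. subgroup K H \<and> K \<subseteq> f ` carrier G \<and> card K = k}"
  proof (rule bij_betw_imageI)
    show "inj_on (image f) {K. subgroup K G \<and> card K = k}"
      by (rule inj_onI) (metis (no_types, lifting) assms(4) inj_on_image_eq_iff mem_Collect_eq subgroup.subset)
    show "image f ` {K. subgroup K G \<and> card K = k} = {K. subgroup K H \<and> K \<subseteq> f ` carrier G \<and> card K = k}"
    proof (intro equalityI subsetI)
      fix L assume "L \<in> image f ` {K. subgroup K G \<and> card K = k}"
      then show "L \<in> {K. subgroup K H \<and> K \<subseteq> f ` carrier G \<and> card K = k}"
        using subgroup_img_is_subgroup card_image by (auto dest: subgroup.mem_carrier)
    next
      fix L assume "L \<in> {K. subgroup K H \<and> K \<subseteq> f ` carrier G \<and> card K = k}"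
      then have L: "subgroup L H" "L \<subseteq> f ` carrier G" "card L = k" by auto
      let ?K = "{x \<in> carrier G. f x \<in> L}"
      have "f ` ?K = L" using L(2) by auto
      then show "L \<in> image f ` {K. subgroup K G \<and> card K = k}"
        using subgroup_preimage[OF L(1)] card_image[OF subgroup_preimage[OF L(1)]] L(3) by auto
    qed
  qed
  then show ?thesis
    unfolding num_subgroups_of_order_def by (simp add: bij_betw_same_card)
qed

lemma num_subgroups_of_order_iso:
  assumes "group G" "group H" "f \<in> iso G H"
  shows "num_subgroups_of_order G k = num_subgroups_of_order H k"
proof -
  have f: "f \<in> hom G H" "inj_on f (carrier G)" "f ` carrier G = carrier H"
    using assms(3) by (auto simp: iso_def bij_betw_def)
  have "{K. subgroup K H \<and> K \<subseteq> carrier H \<and> card K = k} = {K. subgroup K H \<and> card K = k}"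
    by (auto dest: subgroup.mem_carrier)
  with card_subgroups_inj_hom[OF assms(1,2) f(1,2), of k] show ?thesis
    by (simp add: f(3) num_subgroups_of_order_def)
qed

text \<open>A subgroup containing \<open>(x, 1)\<close> is the preimage, under the sheared projection
  \<open>(y, t) \<mapsto> y x\<^sup>-\<^sup>t\<close>, of its intersection with the first factor.\<close>

definition shear :: "('a, 'm) monoid_scheme \<Rightarrow> 'a \<Rightarrow> 'a \<times> int \<Rightarrow> 'a" where
  "shear A x = (\<lambda>(y, t). y \<otimes>\<^bsub>A\<^esub> x [^]\<^bsub>A\<^esub> (- t))"

lemma (in group) int_pow_mod_exponent:
  assumes "x \<in> carrier G" "x [^] n = \<one>"
  shows "x [^] (i mod int n) = x [^] i"
proof -
  have "x [^] i = x [^] (int n * (i div int n)) \<otimes> x [^] (i mod int n)"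
    using assms(1) by (simp flip: int_pow_mult)
  also have "x [^] (int n * (i div int n)) = \<one>"
    using assms by (metis int_pow_int int_pow_one int_pow_pow)
  finally show ?thesis using assms(1) by simp
qed

locale cyclic_extension = comm_group A for A (structure) +
  fixes n :: nat
  assumes fin: "finite (carrier A)"
    and n: "1 < n"
    and exponent: "x \<in> carrier A \<Longrightarrow> x [^] n = \<one>"
begin

abbreviation "C \<equiv> integer_mod_group n"

lemma group_DirProd: "group (A \<times>\<times> C)"
  by (simp add: DirProd_group group_axioms)

lemma carrier_C: "carrier C = {0..<int n}"
  using n by (simp add: carrier_integer_mod_group)

text \<open>Second coordinates are added modulo \<open>n\<close>; the exponent hypothesis makes
  powers of \<open>x\<close> insensitive to this reduction, and commutativity does the rest.\<close>

lemma shear_hom: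
  assumes "x \<in> carrier A"
  shows "group_hom (A \<times>\<times> C) A (shear A x)"
proof -
  have "x [^] (- ((s + t) mod int n)) = x [^] (- s) \<otimes> x [^] (- t)" for s t
    using int_pow_mod_exponent[OF assms exponent[OF assms]] assms
    by (simp add: int_pow_neg int_pow_mult inv_mult)
  then show ?thesis
    using assms group_DirProd
    by (auto simp: group_hom_def group_hom_axioms_def shear_def hom_def group_axioms m_ac)
qed

definition ext :: "'a set \<Rightarrow> 'a \<Rightarrow> ('a \<times> int) set" where
  "ext K x = {z \<in> carrier (A \<times>\<times> C). shear A x z \<in> K}"

lemma subgroup_ext: "subgroup K A \<Longrightarrow> x \<in> carrier A \<Longrightarrow> subgroup (ext K x) (A \<times>\<times> C)"
  unfolding ext_def by (rule group_hom.subgroup_preimage[OF shear_hom])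

lemma mem_ext_generator:
  assumes "subgroup K A" "x \<in> carrier A"
  shows "(x, 1) \<in> ext K x"
  using assms n by (auto simp: ext_def shear_def carrier_C int_pow_neg subgroup.one_closed)

lemma kernel_ext:
  assumes "subgroup K A" "x \<in> carrier A"
  shows "(y, 0) \<in> ext K x \<longleftrightarrow> y \<in> K"
  using assms by (auto simp: ext_def shear_def dest: subgroup.mem_carrier)

text \<open>The fibre over each \<open>t\<close> is the coset of \<open>K\<close> by
  \<open>x [^] t\<close>, so there are \<open>n\<close> fibres of size
  \<open>card K\<close>.\<close>

lemma card_ext:
  assumes "subgroup K A" "x \<in> carrier A"
  shows "card (ext K x) = n * card K"
proof -
  have K: "y \<in> carrier A" if "y \<in> K" for y using subgroup.mem_carrier[OF assms(1) that] .
  have "bij_betw (\<lambda>(y, t). (y \<otimes> x [^] t, t)) (K \<times> {0..<int n}) (ext K x)"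
    by (rule bij_betwI[where g = "\<lambda>(y, t). (shear A x (y, t), t)"])
       (use assms(2) in \<open>auto simp: ext_def shear_def carrier_C K m_assoc simp flip: int_pow_mult\<close>)
  then have "card (ext K x) = card (K \<times> {0..<int n})"
    by (simp add: bij_betw_same_card)
  then show ?thesis by (simp add: card_cartesian_product)
qed

lemma subgroup_kernel:
  assumes "subgroup H (A \<times>\<times> C)"
  shows "subgroup {y. (y, 0) \<in> H} A"
proof -
  have "(\<lambda>y. (y, 0)) \<in> hom A (A \<times>\<times> C)"
    by (auto simp: hom_def)
  then have "group_hom A (A \<times>\<times> C) (\<lambda>y. (y, 0))"
    by (simp add: group_hom_def group_hom_axioms_def group_axioms group_DirProd)
  from group_hom.subgroup_preimage[OF this assms]
  have "subgroup {y \<in> carrier A. (y, 0) \<in> H} A" .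
  moreover have "{y \<in> carrier A. (y, 0) \<in> H} = {y. (y, 0) \<in> H}"
    using subgroup.subset[OF assms] by auto
  ultimately show ?thesis by simp
qed

lemma int_pow_DirProd:
  assumes "y \<in> carrier A" "t \<in> carrier C"
  shows "(y, t) [^]\<^bsub>A \<times>\<times> C\<^esub> (i::int) = (y [^] i, (i * t) mod int n)"
proof -
  have "fst \<in> hom (A \<times>\<times> C) A" "snd \<in> hom (A \<times>\<times> C) C"
    by (auto simp: hom_def)
  from hom_int_pow[OF this(1), of "(y, t)" i] hom_int_pow[OF this(2), of "(y, t)" i]
  show ?thesis
    using assms group_DirProd group_axioms by (auto simp: prod_eq_iff int_pow_integer_mod_group)
qed

text \<open>Multiplying by powers of \<open>(x, 1)\<close> moves \<open>(y, t)\<close> to second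
  coordinate 0 and back without leaving \<open>H\<close>.\<close>

lemma eq_ext:
  assumes "subgroup H (A \<times>\<times> C)" "(x, 1) \<in> H"
  shows "H = ext {y. (y, 0) \<in> H} x"
proof -
  interpret P: group "A \<times>\<times> C" by (rule group_DirProd)
  interpret H: subgroup H "A \<times>\<times> C" by fact
  have x: "x \<in> carrier A" and one: "1 \<in> carrier C" using H.subset assms(2) by auto
  have iff: "(y, t) \<in> H \<longleftrightarrow> (y \<otimes> x [^] (- t), 0) \<in> H" if "y \<in> carrier A" "t \<in> carrier C" for y t
  proof -
    have g: "(x, 1) [^]\<^bsub>A \<times>\<times> C\<^esub> i \<in> H" for i :: int
      using P.subgroup_int_pow_closed[OF assms] .
    have t: "t mod int n = t" using that(2) by (simp add: carrier_C)
    have 1: "(y, t) \<otimes>\<^bsub>A \<times>\<times> C\<^esub> (x, 1) [^]\<^bsub>A \<times>\<times> C\<^esub> (- t) = (y \<otimes> x [^] (- t), 0)"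
      using x one by (simp add: int_pow_DirProd mod_add_right_eq)
    have 2: "(y \<otimes> x [^] (- t), 0) \<otimes>\<^bsub>A \<times>\<times> C\<^esub> (x, 1) [^]\<^bsub>A \<times>\<times> C\<^esub> t = (y, t)"
      using x one that t by (simp add: int_pow_DirProd m_assoc flip: int_pow_mult)
    show ?thesis using H.m_closed g 1 2 by metis
  qed
  show ?thesis
    using H.subset by (auto simp: ext_def shear_def iff)
qed

lemma card_eq_card_kernel:
  assumes "subgroup H (A \<times>\<times> C)" "(x, 1) \<in> H"
  shows "card H = n * card {y. (y, 0) \<in> H}"
proof -
  have "x \<in> carrier A" using assms subgroup.subset by fastforce
  then show ?thesis
    using card_ext[OF subgroup_kernel[OF assms(1)]] eq_ext[OF assms] by metis
qed

text \<open>The elements \<open>x'\<close> with \<open>(x', 1)\<close> in \<open>H\<close> form one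
  coset of the kernel, the one through \<open>x\<close>.\<close>

lemma card_fibre_eq_card_kernel:
  assumes "subgroup H (A \<times>\<times> C)" "(x, 1) \<in> H"
  shows "card {x'. (x', 1) \<in> H} = card {y. (y, 0) \<in> H}"
proof -
  have x: "x \<in> carrier A" and sub: "H \<subseteq> carrier (A \<times>\<times> C)"
    using subgroup.subset[OF assms(1)] assms(2) by auto
  let ?K = "{y. (y, 0) \<in> H}"
  have one: "1 \<in> carrier C" using n by (simp add: carrier_C)
  have H: "(x', 1) \<in> H \<longleftrightarrow> x' \<in> carrier A \<and> x' \<otimes> inv x \<in> ?K" for x'
    by (subst eq_ext[OF assms]) (use one x in \<open>auto simp: ext_def shear_def int_pow_neg\<close>)
  have "bij_betw (\<lambda>y. y \<otimes> x) ?K {x'. (x', 1) \<in> H}"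
    by (rule bij_betwI[where g = "\<lambda>y. y \<otimes> inv x"])
       (use x sub in \<open>auto simp: H m_assoc\<close>)
  then show ?thesis by (simp add: bij_betw_same_card)
qed

text \<open>Double counting of the pairs \<open>(H, x)\<close> with \<open>(x, 1)\<close> in
  \<open>H\<close>: each \<open>H\<close> has \<open>k\<close> such \<open>x\<close>, and the pairs
  correspond to arbitrary pairs \<open>(K, x)\<close>. This avoids choosing coset
  representatives.\<close>

lemma card_surjecting:
  "card {H. subgroup H (A \<times>\<times> C) \<and> card H = n * k \<and> (\<exists>x. (x, 1) \<in> H)} * k
     = order A * num_subgroups_of_order A k"
proof -
  let ?S = "{H. subgroup H (A \<times>\<times> C) \<and> card H = n * k \<and> (\<exists>x. (x, 1) \<in> H)}"
  let ?T = "{K. subgroup K A \<and> card K = k}"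
  have S: "card {y. (y, 0) \<in> H} = k" "card {x. (x, 1) \<in> H} = k" if H: "H \<in> ?S" for H
  proof -
    obtain x where x: "(x, 1) \<in> H" "subgroup H (A \<times>\<times> C)" "card H = n * k" using H by auto
    then show "card {y. (y, 0) \<in> H} = k" using card_eq_card_kernel[OF x(2,1)] n by simp
    then show "card {x. (x, 1) \<in> H} = k" using card_fibre_eq_card_kernel[OF x(2,1)] by simp
  qed
  have sub: "H \<subseteq> carrier A \<times> {0..<int n}" if "H \<in> ?S" for H
    using that subgroup.subset[of H "A \<times>\<times> C"] by (simp add: carrier_C)
  have "finite ?S"
    by (rule finite_subset[of _ "Pow (carrier A \<times> {0..<int n})"]) (use fin sub in auto)
  moreover have "finite {x. (x, 1) \<in> H}" if "H \<in> ?S" for H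
    by (rule finite_subset[OF _ fin]) (use sub[OF that] in auto)
  ultimately have "card (SIGMA H:?S. {x. (x, 1) \<in> H}) = card ?S * k"
    using S(2) by (subst card_SigmaI) auto
  moreover have "bij_betw (\<lambda>(H, x). ({y. (y, 0) \<in> H}, x))
      (SIGMA H:?S. {x. (x, 1) \<in> H}) (?T \<times> carrier A)"
  proof (rule bij_betwI[where g = "\<lambda>(K, x). (ext K x, x)"])
    show "(\<lambda>(H, x). ({y. (y, 0) \<in> H}, x)) \<in> (SIGMA H:?S. {x. (x, 1) \<in> H}) \<rightarrow> ?T \<times> carrier A"
      using S(1) subgroup_kernel sub by fastforce
    show "(\<lambda>(K, x). (ext K x, x)) \<in> ?T \<times> carrier A \<rightarrow> (SIGMA H:?S. {x. (x, 1) \<in> H})"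
      using subgroup_ext card_ext mem_ext_generator by fastforce
  qed (auto simp: kernel_ext eq_ext[symmetric])
  then have "card (SIGMA H:?S. {x. (x, 1) \<in> H}) = card (?T \<times> carrier A)"
    by (rule bij_betw_same_card)
  ultimately show ?thesis
    by (simp add: card_cartesian_product order_def num_subgroups_of_order_def
        mult.commute[of "card (carrier A)"])
qed

end

section \<open>The recurrence for prime powers\<close>

locale prime_power_extension = comm_group A for A (structure) +
  fixes p a :: nat
  assumes fin: "finite (carrier A)"
    and p: "prime p"
    and exponent: "x \<in> carrier A \<Longrightarrow> x [^] (p ^ Suc a) = \<one>"

sublocale prime_power_extension \<subseteq> cyclic_extension A "p ^ Suc a"
  using fin exponent prime_gt_1_nat[OF p] one_less_power[of p "Suc a"]
  by unfold_locales simp_all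

context prime_power_extension
begin

abbreviation "C' \<equiv> integer_mod_group (p ^ a)"

lemma carrier_C': "carrier C' = {0..<int (p ^ a)}"
  using p by (simp add: carrier_integer_mod_group prime_gt_0_nat)

text \<open>Embeds \<open>C'\<close> as the maximal subgroup of the cyclic \<open>p\<close>-group
  \<open>C\<close>, leaving the first coordinate alone.\<close>

definition incl :: "'a \<times> int \<Rightarrow> 'a \<times> int" where
  "incl = (\<lambda>(y, t). (y, int p * t))"

lemma image_incl: "incl ` carrier (A \<times>\<times> C') = {(y, t) \<in> carrier (A \<times>\<times> C). int p dvd t}"
proof -
  have "int p * t < int p * int p ^ a \<longleftrightarrow> t < int p ^ a" "0 \<le> int p * t \<longleftrightarrow> 0 \<le> t" for t
    using prime_gt_0_nat[OF p] by (simp_all add: zero_le_mult_iff)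
  then show ?thesis
    using prime_gt_0_nat[OF p] by (force simp: incl_def carrier_C[simplified] carrier_C' image_iff elim!: dvdE)
qed

lemma incl_hom: "incl \<in> hom (A \<times>\<times> C') (A \<times>\<times> C)"
proof (rule homI)
  show "incl z \<in> carrier (A \<times>\<times> C)" if "z \<in> carrier (A \<times>\<times> C')" for z
    using imageI[OF that, of incl] unfolding image_incl by auto
qed (auto simp: incl_def mod_mult_mult1 simp flip: distrib_left)

text \<open>A residue not divisible by \<open>p\<close> is a unit modulo \<open>p ^ Suc a\<close>,
  so some power of an element outside the image of \<open>incl\<close> has second coordinate
  1.\<close>

lemma surjecting_iff:
  assumes "subgroup H (A \<times>\<times> C)"
  shows "(\<exists>x. (x, 1) \<in> H) \<longleftrightarrow> \<not> H \<subseteq> incl ` carrier (A \<times>\<times> C')"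
proof
  assume "\<exists>x. (x, 1) \<in> H"
  moreover have "\<not> int p dvd 1" using prime_gt_1_nat[OF p] by simp
  ultimately show "\<not> H \<subseteq> incl ` carrier (A \<times>\<times> C')"
    unfolding image_incl by auto
next
  interpret P: group "A \<times>\<times> C" by (rule group_DirProd)
  assume "\<not> H \<subseteq> incl ` carrier (A \<times>\<times> C')"
  then obtain y t where yt: "(y, t) \<in> H" "y \<in> carrier A" "t \<in> carrier C" "\<not> int p dvd t"
    using subgroup.subset[OF assms] unfolding image_incl by auto
  have "coprime t (int (p ^ Suc a))"
    using p yt(4) prime_imp_coprime[of "int p" t] by (simp add: coprime_commute)
  \<comment> \<open>The Bezout coefficient \<open>s\<close> inverts \<open>t\<close> modulo
    \<open>p ^ Suc a\<close>; it is the power to be taken.\<close>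
  then obtain s v where "s * t + v * int (p ^ Suc a) = 1"
    by (metis bezout_int coprime_imp_gcd_eq_1)
  then have "(s * t) mod int (p ^ Suc a) = 1 mod int (p ^ Suc a)"
    by (metis mod_mult_self1)
  also have "\<dots> = 1" using n by (intro mod_pos_pos_trivial) linarith+
  finally have "(y, t) [^]\<^bsub>A \<times>\<times> C\<^esub> s = (y [^] s, 1)"
    using yt by (simp add: int_pow_DirProd del: power_Suc)
  then show "\<exists>x. (x, 1) \<in> H"
    using P.subgroup_int_pow_closed[OF assms yt(1)] by metis
qed

text \<open>A subgroup containing some \<open>(x, 1)\<close> has order divisible by
  \<open>p ^ Suc a\<close>, so it contributes only when \<open>a < b\<close>; this guard also keeps
  \<open>b - Suc a\<close> from truncating.\<close>

lemma num_subgroups_recurrence: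
  "real (num_subgroups_of_order (A \<times>\<times> C) (p ^ b)) =
     real (num_subgroups_of_order (A \<times>\<times> C') (p ^ b)) +
     (if a < b then real (order A) * real (num_subgroups_of_order A (p ^ (b - Suc a))) / real p ^ (b - Suc a)
      else 0)"
proof -
  define S where "S = {H. subgroup H (A \<times>\<times> C) \<and> card H = p ^ b \<and> (\<exists>x. (x, 1) \<in> H)}"
  let ?T = "{H. subgroup H (A \<times>\<times> C) \<and> H \<subseteq> incl ` carrier (A \<times>\<times> C') \<and> card H = p ^ b}"
  have fin': "finite {H. subgroup H (A \<times>\<times> C) \<and> card H = p ^ b}"
  proof (rule finite_subset)
    show "{H. subgroup H (A \<times>\<times> C) \<and> card H = p ^ b} \<subseteq> Pow (carrier (A \<times>\<times> C))"
      using subgroup.subset by blast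
    show "finite (Pow (carrier (A \<times>\<times> C)))"
      using fin by (simp add: carrier_C del: power_Suc)
  qed
  have inj: "inj_on incl (carrier (A \<times>\<times> C'))"
    using prime_gt_0_nat[OF p] by (auto simp: inj_on_def incl_def)
  have "card ?T = num_subgroups_of_order (A \<times>\<times> C') (p ^ b)"
    by (rule card_subgroups_inj_hom) (simp_all add: DirProd_group group_axioms incl_hom inj
        del: carrier_DirProd power_Suc)
  moreover have "{H. subgroup H (A \<times>\<times> C) \<and> card H = p ^ b} = ?T \<union> S" "?T \<inter> S = {}"
    using surjecting_iff unfolding S_def by blast+
  then have "num_subgroups_of_order (A \<times>\<times> C) (p ^ b) = card ?T + card S"
    unfolding num_subgroups_of_order_def using fin' by (simp add: card_Un_disjoint)
  moreover have "real (card S) = (if a < b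
      then real (order A) * real (num_subgroups_of_order A (p ^ (b - Suc a))) / real p ^ (b - Suc a) else 0)"
  proof (cases "a < b")
    case True
    then have "p ^ b = p ^ Suc a * p ^ (b - Suc a)"
      by (simp flip: power_add power_Suc)
    then have "card S * p ^ (b - Suc a) = order A * num_subgroups_of_order A (p ^ (b - Suc a))"
      unfolding S_def using card_surjecting by presburger
    then have "real (card S) * real p ^ (b - Suc a) =
        real (order A) * real (num_subgroups_of_order A (p ^ (b - Suc a)))"
      by (simp flip: of_nat_mult of_nat_power)
    then show ?thesis
      using True prime_gt_0_nat[OF p] by (simp add: field_simps)
  next
    case False
    have "H \<notin> S" for H
    proof
      assume "H \<in> S"
      then have "p ^ Suc a dvd p ^ b"
        unfolding S_def using card_eq_card_kernel by (auto simp del: power_Suc) (metis dvd_triv_left)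
      then show False
        using False p prime_gt_1_nat power_dvd_imp_le by (metis not_less_eq_eq linorder_not_less)
    qed
    then have "S = {}" by blast
    with False show ?thesis by simp
  qed
  ultimately show ?thesis by simp
qed

end

section \<open>Products of two and three cyclic groups\<close>

abbreviation cyc :: "nat \<Rightarrow> nat \<Rightarrow> int monoid" where
  "cyc p a \<equiv> integer_mod_group (p ^ a)"

lemma carrier_cyc: "prime p \<Longrightarrow> carrier (cyc p a) = {0..<int p ^ a}"
  by (simp add: carrier_integer_mod_group prime_gt_0_nat)

lemma comm_group_DirProd:
  assumes "comm_group G" "comm_group H"
  shows "comm_group (G \<times>\<times> H)"
proof -
  interpret G: comm_group G by fact
  interpret H: comm_group H by fact
  show ?thesis
    by (rule group.group_comm_groupI)
       (auto simp: DirProd_group G.group_axioms H.group_axioms G.m_comm H.m_comm)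
qed

lemma nat_pow_DirProd:
  assumes "group G" "group H" "z \<in> carrier (G \<times>\<times> H)"
  shows "z [^]\<^bsub>G \<times>\<times> H\<^esub> (k::nat) = (fst z [^]\<^bsub>G\<^esub> k, snd z [^]\<^bsub>H\<^esub> k)"
proof -
  have "fst \<in> hom (G \<times>\<times> H) G" "snd \<in> hom (G \<times>\<times> H) H"
    by (auto simp: hom_def)
  from hom_nat_pow[OF this(1) assms(3)] hom_nat_pow[OF this(2) assms(3)] assms show ?thesis
    by (simp add: DirProd_group prod_eq_iff)
qed

definition nsub2 :: "nat \<Rightarrow> nat \<Rightarrow> nat \<Rightarrow> nat \<Rightarrow> nat" where
  "nsub2 p a b k = num_subgroups_of_order (cyc p a \<times>\<times> cyc p b) (p ^ k)"

text \<open>Nested to the left, so that the first two factors form the \<open>A\<close> and the last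
  one the \<open>C\<close> of the recurrence.\<close>

definition nsub3 :: "nat \<Rightarrow> nat \<Rightarrow> nat \<Rightarrow> nat \<Rightarrow> nat \<Rightarrow> nat" where
  "nsub3 p a b c k = num_subgroups_of_order ((cyc p a \<times>\<times> cyc p b) \<times>\<times> cyc p c) (p ^ k)"

lemma pow_cyc:
  assumes "a \<le> m"
  shows "x [^]\<^bsub>cyc p a\<^esub> (p ^ m) = 0"
proof -
  have "int (p ^ a) dvd int (p ^ m) * x"
    using assms by (simp add: le_imp_power_dvd)
  then show ?thesis by (simp add: mod_eq_0_iff_dvd)
qed

lemma prime_power_extension_cyc:
  assumes "prime p" "a \<le> Suc m"
  shows "prime_power_extension (cyc p a) p m"
proof -
  interpret comm_group "cyc p a" by simp
  show ?thesis
    using assms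
    by unfold_locales (auto simp: carrier_cyc pow_cyc simp del: pow_integer_mod_group power_Suc)
qed

lemma prime_power_extension_cyc2:
  assumes "prime p" "a \<le> Suc m" "b \<le> Suc m"
  shows "prime_power_extension (cyc p a \<times>\<times> cyc p b) p m"
proof -
  interpret comm_group "cyc p a \<times>\<times> cyc p b" by (simp add: comm_group_DirProd)
  show ?thesis
    using assms
    by unfold_locales
       (auto simp: carrier_cyc pow_cyc nat_pow_DirProd simp del: pow_integer_mod_group power_Suc)
qed

lemma order_cyc: "prime p \<Longrightarrow> order (cyc p a) = p ^ a"
  by (simp add: order_def carrier_cyc nat_power_eq)

lemma order_cyc2: "prime p \<Longrightarrow> order (cyc p a \<times>\<times> cyc p b) = p ^ (a + b)"
  by (simp add: order_def carrier_cyc nat_power_eq card_cartesian_product power_add)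

section \<open>Trivial groups, reordering of factors and the rank one count\<close>

lemma num_subgroups_order_1:
  assumes "group G"
  shows "num_subgroups_of_order G 1 = 1"
proof -
  interpret group G by fact
  have "{H. subgroup H G \<and> card H = 1} = {{\<one>\<^bsub>G\<^esub>}}"
    using triv_subgroup subgroup.one_closed by (auto simp: card_1_singleton_iff)
  then show ?thesis by (simp add: num_subgroups_of_order_def)
qed

lemma num_subgroups_not_dvd:
  assumes "group G" "\<not> k dvd order G"
  shows "num_subgroups_of_order G k = 0"
proof -
  have "{H. subgroup H G \<and> card H = k} = {}"
    using assms group.lagrange by (metis (mono_tags, lifting) Collect_empty_eq dvd_triv_right)
  then show ?thesis unfolding num_subgroups_of_order_def by (metis card.empty)
qed

lemma num_subgroups_trivial:
  assumes "group G" "order G = 1" "1 < p"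
  shows "num_subgroups_of_order G (p ^ k) = (if k = 0 then 1 else 0)"
proof (cases "k = 0")
  case True
  then show ?thesis using num_subgroups_order_1[OF assms(1)] by simp
next
  case False
  then have "1 < p ^ k" using assms(3) by (intro one_less_power) simp_all
  then have "\<not> p ^ k dvd order G" using assms(2,3) False by simp
  then show ?thesis using num_subgroups_not_dvd[OF assms(1)] False by simp
qed

lemma iso_swap: "(\<lambda>(x, y). (y, x)) \<in> iso (G \<times>\<times> H) (H \<times>\<times> G)"
  by (auto simp: iso_def hom_def bij_betw_def inj_on_def)

text \<open>The recurrence shrinks the last factor, which can break the increasing order of the
  exponents; this and the next swaps restore it.\<close>

lemma nsub2_swap: "nsub2 p a b k = nsub2 p b a k"
  unfolding nsub2_def
  by (rule num_subgroups_of_order_iso[OF _ _ iso_swap]) (simp_all add: DirProd_group)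

lemma nsub3_swap12: "nsub3 p a b c k = nsub3 p b a c k"
proof -
  have "(\<lambda>((x, y), z). ((y, x), z)) \<in> iso ((cyc p a \<times>\<times> cyc p b) \<times>\<times> cyc p c) ((cyc p b \<times>\<times> cyc p a) \<times>\<times> cyc p c)"
    by (auto simp: iso_def hom_def bij_betw_def inj_on_def image_iff)
  then show ?thesis unfolding nsub3_def
    by (intro num_subgroups_of_order_iso) (simp_all add: DirProd_group)
qed

lemma nsub3_swap23: "nsub3 p a b c k = nsub3 p a c b k"
proof -
  have "(\<lambda>((x, y), z). ((x, z), y)) \<in> iso ((cyc p a \<times>\<times> cyc p b) \<times>\<times> cyc p c) ((cyc p a \<times>\<times> cyc p c) \<times>\<times> cyc p b)"
    by (auto simp: iso_def hom_def bij_betw_def inj_on_def image_iff)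
  then show ?thesis unfolding nsub3_def
    by (intro num_subgroups_of_order_iso) (simp_all add: DirProd_group)
qed

lemma hsub_eq_nsub3: "hsub c b a p k = nsub3 p a b c k"
proof -
  have "(\<lambda>(x, y, z). ((x, y), z)) \<in> iso (rank3_group p a b c) ((cyc p a \<times>\<times> cyc p b) \<times>\<times> cyc p c)"
    unfolding rank3_group_def by (auto simp: iso_def hom_def bij_betw_def inj_on_def image_iff)
  moreover have "group (rank3_group p a b c)" "group ((cyc p a \<times>\<times> cyc p b) \<times>\<times> cyc p c)"
    by (simp_all add: DirProd_group rank3_group_def)
  ultimately show ?thesis unfolding nsub3_def hsub_def
    by (rule num_subgroups_of_order_iso[rotated 2])
qed

lemma nsub2_Suc:
  assumes "prime p" "a \<le> Suc c"
  shows "real (nsub2 p a (Suc c) k) = real (nsub2 p a c k) +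
    (if c < k then real p ^ a * real (num_subgroups_of_order (cyc p a) (p ^ (k - Suc c))) / real p ^ (k - Suc c) else 0)"
  using prime_power_extension.num_subgroups_recurrence[OF prime_power_extension_cyc[OF assms], of k]
  by (simp add: nsub2_def order_cyc[OF assms(1)] del: power_Suc)

lemma nsub3_Suc:
  assumes "prime p" "a \<le> Suc c" "b \<le> Suc c"
  shows "real (nsub3 p a b (Suc c) k) = real (nsub3 p a b c k) +
    (if c < k then real p ^ (a + b) * real (nsub2 p a b (k - Suc c)) / real p ^ (k - Suc c) else 0)"
  using prime_power_extension.num_subgroups_recurrence[OF prime_power_extension_cyc2[OF assms], of k]
  by (simp add: nsub3_def nsub2_def order_cyc2[OF assms(1)] del: power_Suc)

lemma nsub2_0_0:
  assumes "prime p"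
  shows "nsub2 p 0 0 k = (if k = 0 then 1 else 0)"
  unfolding nsub2_def using prime_gt_1_nat[OF assms]
  by (intro num_subgroups_trivial) (simp_all add: DirProd_group order_def carrier_integer_mod_group)

text \<open>A trivial first factor lets the rank two recurrence treat a single cyclic group.\<close>

lemma num_subgroups_cyc_eq_nsub2:
  assumes "prime p"
  shows "num_subgroups_of_order (cyc p a) (p ^ k) = nsub2 p 0 a k"
proof -
  have "carrier (integer_mod_group (Suc 0)) = {0}"
    by (auto simp: carrier_integer_mod_group)
  then have "(\<lambda>x. (0, x)) \<in> iso (cyc p a) (cyc p 0 \<times>\<times> cyc p a)"
    by (simp add: iso_def hom_def bij_betw_def inj_on_def image_iff set_eq_iff)
  then show ?thesis unfolding nsub2_def
    by (intro num_subgroups_of_order_iso) (simp_all add: DirProd_group)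
qed

lemma num_subgroups_cyc:
  assumes "prime p"
  shows "num_subgroups_of_order (cyc p a) (p ^ k) = (if k \<le> a then 1 else 0)"
proof -
  have "real (nsub2 p 0 a k) = (if k \<le> a then 1 else 0)"
  proof (induction a)
    case 0
    show ?case by (simp add: nsub2_0_0[OF assms])
  next
    case (Suc a)
    \<comment> \<open>The subtraction truncates to 0 for every \<open>k \<le> Suc a\<close>; under
      the guard \<open>a < k\<close> of the recurrence only \<open>k = Suc a\<close> survives,
      giving one new subgroup.\<close>
    have "num_subgroups_of_order (cyc p 0) (p ^ (k - Suc a)) = (if k \<le> Suc a then 1 else 0)"
      unfolding num_subgroups_cyc_eq_nsub2[OF assms] by (simp add: nsub2_0_0[OF assms])
    with Suc nsub2_Suc[OF assms, of 0 a k] show ?case by (cases "k = Suc a") auto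
  qed
  then show ?thesis
    by (simp add: num_subgroups_cyc_eq_nsub2[OF assms] split: if_splits)
qed

lemma nsub3_0_0_0:
  assumes "prime p"
  shows "nsub3 p 0 0 0 k = (if k = 0 then 1 else 0)"
  unfolding nsub3_def using prime_gt_1_nat[OF assms]
  by (intro num_subgroups_trivial) (simp_all add: DirProd_group order_def carrier_integer_mod_group)

section \<open>The closed form\<close>

context
  fixes q :: real
begin

text \<open>
  With \<open>d = a + b + c - k\<close>, the numerators of the cases of the theorem are \<open>fA\<close> (Cases 1 and 10, at \<open>k\<close>
  and at \<open>d\<close>), \<open>fB\<close> (2 and 9), \<open>fC\<close> (3 and 4 at \<open>k\<close>, 7 and 8 at \<open>d\<close>), \<open>fD\<close> (5) and \<open>fE\<close> (6).
  Integer parameters and exponents let \<open>d = -1\<close> be admitted, where the count is 0.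
\<close>

definition fA :: "int \<Rightarrow> real" where
  "fA k = q powi (k + k + 3) - q powi (k + 2) - q powi (k + 1) + 1"

definition fB :: "int \<Rightarrow> int \<Rightarrow> real" where
  "fB a k = q powi (k + a + 3) + q powi (k + a + 2) - q powi (a + a + 2) - q powi (k + 2) - q powi (k + 1) + 1"

definition fC :: "int \<Rightarrow> int \<Rightarrow> int \<Rightarrow> real" where
  "fC a b k = (of_int (k - b) + 1) * q powi (a + b + 3) + q powi (a + b + 2) - of_int (k - b) * q powi (a + b + 1)
     - q powi (a + a + 2) - q powi (k + 2) - q powi (k + 1) + 1"

definition fD :: "int \<Rightarrow> int \<Rightarrow> real" where
  "fD a b = (of_int a + 1) * q powi (a + b + 3) + q powi (a + b + 2) - of_int a * q powi (a + b + 1)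
     - q powi (a + a + 2) - q powi (a + b + 2) - q powi (a + b + 1) + 1"

definition fE :: "int \<Rightarrow> int \<Rightarrow> int \<Rightarrow> int \<Rightarrow> int \<Rightarrow> real" where
  "fE a b c k d = (of_int (c - b) + 1) * q powi (a + b + 3) + 2 * q powi (a + b + 2)
     - (of_int (c - b) - 1) * q powi (a + b + 1) - q powi (d + 2) - q powi (d + 1)
     - q powi (a + a + 2) - q powi (k + 2) - q powi (k + 1) + 1"

definition num3 :: "int \<Rightarrow> int \<Rightarrow> int \<Rightarrow> int \<Rightarrow> real" where
  "num3 a b c k = (let d = a + b + c - k in
     if k \<le> a then fA k
     else if k \<le> b then fB a k
     else if k \<le> c \<and> k \<le> a + b then fC a b k
     else if k \<le> c then fD a b
     else if k \<le> a + b then fE a b c k d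
     else if k \<le> a + c then fC a b d
     else if k \<le> b + c then fB a d
     else fA d)"

text \<open>
  The numerator of the term \<open>|A| h(A) / p\<^sup>j\<close> of the recurrence, for \<open>A\<close> of rank 2 and \<open>j = k - c - 1\<close>; here
  \<open>d\<close> is the complementary exponent in the larger group.
\<close>

definition increment :: "int \<Rightarrow> int \<Rightarrow> int \<Rightarrow> int \<Rightarrow> real" where
  "increment a c d k = (if k \<le> c then 0
     else (q powi (d + min (k - c - 1) (min a d) + 1) - q powi d) * (q\<^sup>2 - 1))"

context
  assumes q: "1 < q"
begin

section \<open>Identities between the numerators\<close>

lemma powi_add: "q powi (x + y) = q powi x * q powi y"
  using q by (simp add: power_int_add)

lemma powi_double: "q powi (2 * x) = q powi x * q powi x"
  using powi_add[of x x] by simp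

lemmas expand = fA_def fB_def fC_def fD_def fE_def powi_add powi_double algebra_simps
  power2_eq_square power3_eq_cube

text \<open>Neighbouring formulas agree at two consecutive arguments. The recurrence moves the
  complementary exponent by one, so a step at a boundary can still be made within one
  formula.\<close>

lemma fA_eq_fB: "fA a = fB a a" "fA (a - 1) = fB a (a - 1)"
proof -
  have "fA z = fB (z + 1) z" for z by (simp add: expand)
  from this[of "a - 1"] show "fA (a - 1) = fB a (a - 1)" by simp
qed (simp add: expand)

lemma fB_eq_fC: "fB a b = fC a b b" "fB a (b - 1) = fC a b (b - 1)"
proof -
  have "fB a z = fC a (z + 1) z" for z by (simp add: expand)
  from this[of "b - 1"] show "fB a (b - 1) = fC a b (b - 1)" by simp
qed (simp add: expand)

lemma fC_eq_fD: "fC a b (a + b) = fD a b"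
  by (simp add: expand)

text \<open>These are the two ends of the range of \<open>fE\<close>, where \<open>(k, d)\<close> is
  \<open>(c, a + b)\<close> or \<open>(a + b, c)\<close>.\<close>

lemma fC_eq_fE: "fC a b c = fE a b c c (a + b)" "fC a b c = fE a b c (a + b) c"
  by (simp_all add: expand)

text \<open>In this and the next identities \<open>d\<close> and \<open>d + 1\<close> are the
  complementary exponents in the smaller and the larger group; the added term is the value of
  \<open>increment\<close> on the range concerned.\<close>

lemma fA_step: "fA (d + 1) = fA d + (q powi (d + 1 + d + 2) - q powi (d + 1)) * (q\<^sup>2 - 1)"
  by (simp add: expand) (simp add: eval_nat_numeral)

lemma fB_step: "fB a (d + 1) = fB a d + (q powi (a + d + 2) - q powi (d + 1)) * (q\<^sup>2 - 1)"
  by (simp add: expand) (simp add: eval_nat_numeral)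

lemma fC_step: "fC a b (d + 1) = fC a b d + (q powi (a + b + 1) - q powi (d + 1)) * (q\<^sup>2 - 1)"
  by (simp add: expand)

text \<open>\<open>fE\<close> involves all three exponents, so its step has three versions: after
  sorting, the exponent that drops is the third, second or first, according to how many are tied for
  the largest.\<close>

lemma fE_step_1:
  "fE a b (c + 1) k (d + 1) = fE a b c k d + (q powi (a + b + 1) - q powi (d + 1)) * (q\<^sup>2 - 1)"
  by (simp add: expand)

lemma fE_step_2:
  "fE a (e + 1) (e + 1) k (d + 1) = fE a e (e + 1) k d + (q powi (a + e + 2) - q powi (d + 1)) * (q\<^sup>2 - 1)"
  by (simp add: expand) (simp add: eval_nat_numeral)

lemma fE_step_3:
  "fE (e + 1) (e + 1) (e + 1) k (d + 1) =
     fE e (e + 1) (e + 1) k d + (q powi (e + e + 3) - q powi (d + 1)) * (q\<^sup>2 - 1)"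
  by (simp add: expand) (simp add: eval_nat_numeral)

section \<open>Validity of each formula on a closed range\<close>

lemma num3_A: "k \<le> a \<Longrightarrow> num3 a b c k = fA k"
  by (simp add: num3_def)

lemma num3_B:
  assumes "a \<le> k" "k \<le> b"
  shows "num3 a b c k = fB a k"
proof (cases "a < k")
  case True
  then show ?thesis using assms by (simp add: num3_def)
next
  case False
  then have "k = a" using assms by simp
  then show ?thesis by (simp add: num3_A fA_eq_fB)
qed

lemma num3_C:
  assumes "a \<le> b" "b \<le> k" "k \<le> c" "k \<le> a + b"
  shows "num3 a b c k = fC a b k"
proof (cases "b < k")
  case True
  then show ?thesis using assms by (simp add: num3_def)
next
  case False
  then have "k = b" using assms by simp
  then show ?thesis using assms by (simp add: num3_B fB_eq_fC)
qed

lemma num3_D: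
  assumes "0 \<le> a" "a \<le> b" "a + b \<le> k" "k \<le> c"
  shows "num3 a b c k = fD a b"
proof (cases "a + b < k")
  case True
  then show ?thesis using assms by (simp add: num3_def)
next
  case False
  then have "k = a + b" using assms by simp
  then show ?thesis using assms by (simp add: num3_C fC_eq_fD)
qed

lemma num3_E:
  assumes "0 \<le> a" "a \<le> b" "b \<le> c" "c \<le> k" "k \<le> a + b"
  shows "num3 a b c k = fE a b c k (a + b + c - k)"
proof (cases "c < k")
  case True
  then show ?thesis using assms by (simp add: num3_def)
next
  case False
  then have "k = c" using assms by simp
  then show ?thesis using assms by (simp add: num3_C fC_eq_fE(1))
qed

lemma num3_A':
  assumes "0 \<le> a" "a \<le> b" "b \<le> c" "b + c < k"
  shows "num3 a b c k = fA (a + b + c - k)"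
  using assms by (simp add: num3_def)

text \<open>The range goes one past its branch, to \<open>k = b + c + 1\<close>, where the
  complementary exponent is \<open>a - 1\<close> and \<open>fA\<close> still agrees with
  \<open>fB\<close>. The corresponding range for \<open>c + 1\<close> in place of \<open>c\<close>
  ends there.\<close>

lemma num3_B':
  assumes "0 \<le> a" "a \<le> b" "b \<le> c" "a + c < k" "k \<le> b + c + 1"
  shows "num3 a b c k = fB a (a + b + c - k)"
proof (cases "k \<le> b + c")
  case True
  then show ?thesis using assms by (simp add: num3_def)
next
  case False
  then have "k = b + c + 1" using assms by simp
  then show ?thesis using assms fA_eq_fB(2)[of a] by (simp add: num3_A')
qed

lemma num3_C'_interior:
  assumes "0 \<le> a" "a \<le> b" "b \<le> c" "c < k" "a + b < k" "k \<le> a + c + 1"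
  shows "num3 a b c k = fC a b (a + b + c - k)"
proof (cases "k \<le> a + c")
  case True
  then show ?thesis using assms by (simp add: num3_def)
next
  case False
  then have "k = a + c + 1" using assms by simp
  then show ?thesis using assms fB_eq_fC(2)[of a b] by (simp add: num3_B')
qed

text \<open>The left end is the larger of \<open>c\<close> and \<open>a + b\<close>; which of them
  it is decides whether the preceding formula is \<open>fE\<close> or \<open>fD\<close>.\<close>

lemma num3_C':
  assumes "0 \<le> a" "a \<le> b" "b \<le> c" "c \<le> k" "a + b \<le> k" "k \<le> a + c + 1"
  shows "num3 a b c k = fC a b (a + b + c - k)"
proof -
  consider "c < k" "a + b < k" | "k = a + b" "c \<le> a + b" | "k = c" "a + b \<le> c"
    using assms by linarith
  then show ?thesis
  proof cases
    case 1
    then show ?thesis using assms num3_C'_interior by blast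
  next
    case 2
    then show ?thesis using assms by (simp add: num3_E fC_eq_fE(2))
  next
    case 3
    then show ?thesis using assms by (simp add: num3_D fC_eq_fD)
  qed
qed

lemma num3_B'_closed:
  assumes "0 \<le> a" "a \<le> b" "b \<le> c" "a + c \<le> k" "k \<le> b + c + 1"
  shows "num3 a b c k = fB a (a + b + c - k)"
proof (cases "a + c < k")
  case True
  then show ?thesis using assms num3_B' by blast
next
  case False
  then have "k = a + c" using assms by simp
  then show ?thesis using assms by (simp add: num3_C' fB_eq_fC)
qed

lemma num3_A'_closed:
  assumes "0 \<le> a" "a \<le> b" "b \<le> c" "b + c \<le> k"
  shows "num3 a b c k = fA (a + b + c - k)"
proof (cases "b + c < k")
  case True
  then show ?thesis using assms num3_A' by blast
next
  case False
  then have "k = b + c" using assms by simp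
  then show ?thesis using assms by (simp add: num3_B'_closed fA_eq_fB)
qed

section \<open>The recurrence for the closed form\<close>

lemma num3_Suc_1:
  fixes a b c k :: int
  defines "x \<equiv> a + b + (c + 1) - k"
  assumes "0 \<le> a" "a \<le> b" "b \<le> c"
  shows "num3 a b (c + 1) k = num3 a b c k + increment a c x k"
proof -
  define d where "d = a + b + c - k"
  have d: "x = d + 1" "a + b + c - k = d" "a + b + (c + 1) - k = d + 1"
    by (simp_all add: d_def x_def)
  consider "k \<le> a" | "a \<le> k" "k \<le> b" | "b \<le> k" "k \<le> c" "k \<le> a + b" | "a + b \<le> k" "k \<le> c"
    | "c + 1 \<le> k" "k \<le> a + b" | "c + 1 \<le> k" "a + b \<le> k" "k \<le> a + c + 1"
    | "a + c + 1 \<le> k" "k \<le> b + c + 1" | "b + c + 1 \<le> k"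
    by linarith
  then show ?thesis
  proof cases
    case 1
    \<comment> \<open>In this and the next three cases \<open>k \<le> c\<close>: the increment
      vanishes and the formula does not involve \<open>c\<close>.\<close>
    then show ?thesis using assms by (simp add: num3_A increment_def)
  next
    case 2
    then show ?thesis using assms by (simp add: num3_B increment_def)
  next
    case 3
    then show ?thesis using assms by (simp add: num3_C increment_def)
  next
    case 4
    then show ?thesis using assms by (simp add: num3_D increment_def)
  next
    case 5
    \<comment> \<open>Here and in the next case the minimum is \<open>k - c - 1\<close>; in the last
      two cases it is \<open>a\<close> and \<open>x\<close>.\<close>
    then have m: "x + min (k - c - 1) (min a x) + 1 = a + b + 1" using assms by simp
    show ?thesis
      using num3_E[of a b "c + 1" k, unfolded d] num3_E[of a b c k, unfolded d] fE_step_1[of a b c k d]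
        assms(2-) 5 unfolding increment_def m unfolding d(1) by simp
  next
    case 6
    then have m: "x + min (k - c - 1) (min a x) + 1 = a + b + 1" using assms by simp
    show ?thesis
      using num3_C'[of a b "c + 1" k, unfolded d] num3_C'[of a b c k, unfolded d] fC_step[of a b d]
        assms(2-) 6 unfolding increment_def m unfolding d(1) by simp
  next
    case 7
    then have m: "x + min (k - c - 1) (min a x) + 1 = a + d + 2" using assms by (simp add: d_def)
    show ?thesis
      using num3_B'_closed[of a b "c + 1" k, unfolded d] num3_B'_closed[of a b c k, unfolded d]
        fB_step[of a d] assms(2-) 7 unfolding increment_def m unfolding d(1) by simp
  next
    case 8
    then have m: "x + min (k - c - 1) (min a x) + 1 = d + 1 + d + 2" using assms by (simp add: d_def)
    show ?thesis
      using num3_A'_closed[of a b "c + 1" k, unfolded d] num3_A'_closed[of a b c k, unfolded d]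
        fA_step[of d] assms(2-) 8 unfolding increment_def m unfolding d(1) by simp
  qed
qed

text \<open>Two exponents are tied for the largest, and shrinking one of them sorts to
  \<open>(a, e, e + 1)\<close>. The rank two group left over has exponents \<open>a\<close> and
  \<open>e + 1\<close>.\<close>

lemma num3_Suc_2:
  fixes a e k :: int
  defines "x \<equiv> a + (e + 1) + (e + 1) - k"
  assumes "0 \<le> a" "a \<le> e"
  shows "num3 a (e + 1) (e + 1) k = num3 a e (e + 1) k + increment a e x k"
proof -
  define d where "d = a + e + e + 1 - k"
  have d: "x = d + 1" "a + e + (e + 1) - k = d" "a + (e + 1) + (e + 1) - k = d + 1"
    by (simp_all add: d_def x_def)
  consider "k \<le> a" | "a \<le> k" "k \<le> e" | "e + 1 \<le> k" "k \<le> a + e"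
    | "a + e + 1 \<le> k" "k \<le> e + e + 2" | "e + e + 2 \<le> k"
    by linarith
  then show ?thesis
  proof cases
    case 1
    then show ?thesis using assms by (simp add: num3_A increment_def)
  next
    case 2
    then show ?thesis using assms by (simp add: num3_B increment_def)
  next
    case 3
    then have m: "x + min (k - e - 1) (min a x) + 1 = a + e + 2" using assms by simp
    show ?thesis
      using num3_E[of a "e + 1" "e + 1" k, unfolded d] num3_E[of a e "e + 1" k, unfolded d]
        fE_step_2[of a e k d] assms(2-) 3 unfolding increment_def m unfolding d(1) by simp
  next
    case 4
    then have m: "x + min (k - e - 1) (min a x) + 1 = a + d + 2" using assms by (simp add: d_def)
    show ?thesis
      using num3_B'_closed[of a "e + 1" "e + 1" k, unfolded d] num3_B'_closed[of a e "e + 1" k, unfolded d]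
        fB_step[of a d] assms(2-) 4 unfolding increment_def m unfolding d(1) by simp
  next
    case 5
    then have m: "x + min (k - e - 1) (min a x) + 1 = d + 1 + d + 2" using assms by (simp add: d_def)
    show ?thesis
      using num3_A'_closed[of a "e + 1" "e + 1" k, unfolded d] num3_A'_closed[of a e "e + 1" k, unfolded d]
        fA_step[of d] assms(2-) 5 unfolding increment_def m unfolding d(1) by simp
  qed
qed

text \<open>All three exponents are tied, so both remaining factors have exponent
  \<open>e + 1\<close>, which takes the place of \<open>a\<close> in the increment.\<close>

lemma num3_Suc_3:
  fixes e k :: int
  defines "x \<equiv> (e + 1) + (e + 1) + (e + 1) - k"
  assumes "0 \<le> e"
  shows "num3 (e + 1) (e + 1) (e + 1) k = num3 e (e + 1) (e + 1) k + increment (e + 1) e x k"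
proof -
  define d where "d = e + e + e + 2 - k"
  have d: "x = d + 1" "e + (e + 1) + (e + 1) - k = d" "(e + 1) + (e + 1) + (e + 1) - k = d + 1"
    by (simp_all add: d_def x_def)
  consider "k \<le> e" | "e + 1 \<le> k" "k \<le> e + e + 1" | "e + e + 2 \<le> k"
    by linarith
  then show ?thesis
  proof cases
    case 1
    then show ?thesis using assms by (simp add: num3_A increment_def)
  next
    case 2
    then have m: "x + min (k - e - 1) (min (e + 1) x) + 1 = e + e + 3" using assms by simp
    show ?thesis
      using num3_E[of "e + 1" "e + 1" "e + 1" k, unfolded d] num3_E[of e "e + 1" "e + 1" k, unfolded d]
        fE_step_3[of e k d] assms(2-) 2 unfolding increment_def m unfolding d(1) by simp
  next
    case 3
    then have m: "x + min (k - e - 1) (min (e + 1) x) + 1 = d + 1 + d + 2" using assms by (simp add: d_def)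
    show ?thesis
      using num3_A'_closed[of "e + 1" "e + 1" "e + 1" k, unfolded d] num3_A'_closed[of e "e + 1" "e + 1" k, unfolded d]
        fA_step[of d] assms(2-) 3 unfolding increment_def m unfolding d(1) by simp
  qed
qed

text \<open>Complementation exchanges the two ranges of each of \<open>fA\<close>, \<open>fB\<close>
  and \<open>fC\<close>. It maps the ranges of \<open>fD\<close> and \<open>fE\<close> to
  themselves, where \<open>fD\<close> is constant and \<open>fE\<close> is symmetric in its last two
  arguments.\<close>

lemma num3_sym:
  assumes "0 \<le> a" "a \<le> b" "b \<le> c" "0 \<le> k"
  shows "num3 a b c (a + b + c - k) = num3 a b c k"
proof -
  have fE: "fE a b c d k = fE a b c k d" for d by (simp add: fE_def)
  consider "k \<le> a" | "a \<le> k" "k \<le> b" | "b \<le> k" "k \<le> c" "k \<le> a + b" | "a + b \<le> k" "k \<le> c"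
    | "c \<le> k" "k \<le> a + b" | "c \<le> k" "a + b \<le> k" "k \<le> a + c"
    | "a + c \<le> k" "k \<le> b + c" | "b + c \<le> k"
    by linarith
  then show ?thesis
    by cases (use assms fE in \<open>simp_all add: num3_A num3_A'_closed num3_B num3_B'_closed num3_C num3_C' num3_D num3_E\<close>)
qed

end

end

section \<open>Counting in ranks two and three\<close>

text \<open>Truncated subtraction makes the exponent 0, hence the count 0, when \<open>k > a + b\<close>.\<close>

lemma nsub2_closed:
  assumes "prime p" "a \<le> b"
  shows "real (nsub2 p a b k) * (real p - 1) = real p ^ min (Suc k) (min (Suc a) (Suc (a + b) - k)) - 1"
  using assms(2)
proof (induction b arbitrary: a)
  case 0
  then show ?case using assms(1) by (simp add: nsub2_0_0)
next
  case (Suc c)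
  have p: "0 < real p" using prime_gt_0_nat[OF assms(1)] by simp
  have step: "real (nsub2 p a (Suc c) k) =
      real (nsub2 p a c k) + (if c < k \<and> k \<le> a + Suc c then real p ^ (a + Suc c - k) else 0)"
    if "a \<le> Suc c" for a
  proof -
    have "real p ^ a / real p ^ (k - Suc c) = real p ^ (a + Suc c - k)" if "c < k" "k - Suc c \<le> a"
      using that p by (simp add: Suc_diff_le flip: power_diff)
    then show ?thesis
      using nsub2_Suc[OF assms(1) that, of k] num_subgroups_cyc[OF assms(1), of a "k - Suc c"] by auto
  qed
  \<comment> \<open>The tied case \<open>a = Suc c\<close> is postponed: shrinking and swapping
    leads to exponents \<open>(c, Suc c)\<close>, an instance of this claim at the same
    \<open>c\<close>.\<close>
  have below: "real (nsub2 p a (Suc c) k) * (real p - 1) =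
      real p ^ min (Suc k) (min (Suc a) (Suc (a + Suc c) - k)) - 1" if a: "a \<le> c" for a
  proof -
    consider "k \<le> c" | "c < k" "k \<le> a + Suc c" | "a + Suc c < k" by linarith
    then show ?thesis
    proof cases
      case 1
      then show ?thesis using step[of a] Suc.IH[OF a] a by (simp add: min_def)
    next
      case 2
      \<comment> \<open>The minimum rises by exactly one, so the recurrence adds the next term of a
        geometric sum.\<close>
      have "min (Suc k) (min (Suc a) (Suc (a + c) - k)) = a + Suc c - k"
        "min (Suc k) (min (Suc a) (Suc (a + Suc c) - k)) = Suc (a + Suc c - k)"
        using 2 a by (auto simp: min_def)
      then show ?thesis using step[of a] Suc.IH[OF a] a 2 by (simp add: algebra_simps)
    next
      case 3
      then show ?thesis using step[of a] Suc.IH[OF a] a by simp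
    qed
  qed
  show ?case
  proof (cases "a \<le> c")
    case True
    then show ?thesis by (rule below)
  next
    case False
    then have a: "a = Suc c" using Suc.prems by simp
    have sw: "nsub2 p (Suc c) c k = nsub2 p c (Suc c) k" by (rule nsub2_swap)
    consider "k \<le> c" | "c < k" "k \<le> a + Suc c" | "a + Suc c < k" by linarith
    then show ?thesis
    proof cases
      case 1
      then show ?thesis using step[of a] below[of c] a sw by (simp add: min_def)
    next
      case 2
      have "min (Suc k) (min (Suc c) (Suc (c + Suc c) - k)) = a + Suc c - k"
        "min (Suc k) (min (Suc a) (Suc (a + Suc c) - k)) = Suc (a + Suc c - k)"
        using 2 a by (auto simp: min_def)
      then show ?thesis using step[of a] below[of c] a 2 sw by (simp add: algebra_simps)
    next
      case 3
      then show ?thesis using step[of a] below[of c] a sw by simp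
    qed
  qed
qed

lemma order_nsub3: "prime p \<Longrightarrow> order ((cyc p a \<times>\<times> cyc p b) \<times>\<times> cyc p c) = p ^ (a + b + c)"
  by (simp add: order_def carrier_cyc nat_power_eq card_cartesian_product power_add)

lemma nsub3_eq_0:
  assumes "prime p" "a + b + c < k"
  shows "nsub3 p a b c k = 0"
proof -
  have "\<not> p ^ k dvd p ^ (a + b + c)"
    using assms power_dvd_imp_le prime_gt_1_nat by (metis linorder_not_less)
  then show ?thesis
    unfolding nsub3_def by (intro num_subgroups_not_dvd) (simp_all add: DirProd_group order_nsub3[OF assms(1)])
qed

text \<open>The factor \<open>real p - 1\<close> clears the denominator of the rank two count, and
  the other factor stays in \<open>increment\<close>. The bound on \<open>k\<close> makes the
  complementary exponent \<open>x\<close> a natural number.\<close>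

lemma nsub3_Suc_closed:
  fixes a b c k p :: nat
  defines "x \<equiv> int a + int b + (int c + 1) - int k"
  assumes p: "prime p" and ab: "a \<le> b" "b \<le> Suc c" and k: "k \<le> a + b + Suc c"
  shows "real (nsub3 p a b (Suc c) k) * ((real p - 1) * ((real p)\<^sup>2 - 1)) =
    real (nsub3 p a b c k) * ((real p - 1) * ((real p)\<^sup>2 - 1)) + increment (real p) (int a) (int c) x (int k)"
proof (cases "c < k")
  case False
  then show ?thesis using nsub3_Suc[OF p, of a c b k] ab by (simp add: increment_def)
next
  case True
  let ?q = "real p"
  define e where "e = min (Suc (k - Suc c)) (min (Suc a) (Suc (a + b) - (k - Suc c)))"
  define y where "y = a + b + Suc c - k"
  have q: "0 < ?q" using prime_gt_0_nat[OF p] by simp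
  have x: "x = int y" using k by (simp add: x_def y_def)
  obtain j where j: "k = Suc c + j" using True less_imp_Suc_add by fastforce
  have "Suc (a + b) - j = Suc y" using k by (simp add: y_def j Suc_diff_le)
  then have e: "x + min (int k - int c - 1) (min (int a) x) + 1 = int (y + e)"
    unfolding x by (simp add: e_def j of_nat_min min_def)
  have y: "?q ^ (a + b) / ?q ^ (k - Suc c) = ?q ^ y"
    using k True q by (simp add: y_def Suc_diff_le flip: power_diff)
  have "real (nsub3 p a b (Suc c) k) = real (nsub3 p a b c k) + ?q ^ y * real (nsub2 p a b (k - Suc c))"
    using nsub3_Suc[OF p, of a c b k] ab True by (simp flip: y)
  then have "real (nsub3 p a b (Suc c) k) * ((?q - 1) * (?q\<^sup>2 - 1)) =
      real (nsub3 p a b c k) * ((?q - 1) * (?q\<^sup>2 - 1))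
      + ?q ^ y * (real (nsub2 p a b (k - Suc c)) * (?q - 1)) * (?q\<^sup>2 - 1)"
    by (simp add: algebra_simps)
  also have "real (nsub2 p a b (k - Suc c)) * (?q - 1) = ?q ^ e - 1"
    unfolding e_def by (rule nsub2_closed[OF p ab(1)])
  also have "?q ^ y * (?q ^ e - 1) = ?q powi (x + min (int k - int c - 1) (min (int a) x) + 1) - ?q powi x"
    unfolding e unfolding x by (simp only: power_int_of_nat power_add right_diff_distrib mult_1_right)
  finally show ?thesis using True by (simp add: increment_def)
qed

text \<open>The range of \<open>k\<close> reaches one beyond the exponent of the group order,
  because the full order of the larger group in a step is already too large for the smaller
  one.\<close>

lemma nsub3_closed:
  assumes "prime p" "a \<le> b" "b \<le> c" "k \<le> Suc (a + b + c)"
  shows "real (nsub3 p a b c k) * ((real p - 1) * ((real p)\<^sup>2 - 1)) = num3 (real p) (int a) (int b) (int c) (int k)"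
  using assms(2-)
proof (induction c arbitrary: a b)
  case 0
  have q: "1 < real p" using prime_gt_1_nat[OF assms(1)] by simp
  have "num3 (real p) 0 0 0 0 = (real p - 1) * ((real p)\<^sup>2 - 1)" "num3 (real p) 0 0 0 1 = 0"
    by (simp_all add: num3_def fA_def algebra_simps power2_eq_square power3_eq_cube)
  moreover have "k = 0 \<or> k = 1" using 0 by auto
  ultimately show ?case using 0 by (auto simp: nsub3_0_0_0[OF assms(1)])
next
  case (Suc c)
  let ?D = "(real p - 1) * ((real p)\<^sup>2 - 1)"
  have q: "1 < real p" using prime_gt_1_nat[OF assms(1)] by simp
  have S: "int (Suc c) = int c + 1" by simp
  have top: "real (nsub3 p a b c k) * ?D = num3 (real p) (int a) (int b) (int c) (int k)"
    if "a \<le> b" "b \<le> c" "k = Suc (a + b + c)" for a b c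
  proof -
    \<comment> \<open>At complementary exponent -1 the numerator is q - q - 1 + 1 = 0 with q =
      \<open>real p\<close>, matching the absence of subgroups.\<close>
    have "num3 (real p) (int a) (int b) (int c) (int k) = fA (real p) (-1)"
      using num3_A'_closed[OF q, of "int a" "int b" "int c" "int k"] that by simp
    then show ?thesis using that by (simp add: nsub3_eq_0[OF assms(1)] fA_def)
  qed
  \<comment> \<open>The cases are chained by ties at the same \<open>c\<close>: with no tie the
    induction hypothesis applies, with two tied exponents claim \<open>1\<close> does, and with
    three claim \<open>2\<close>.\<close>
  have 1: "real (nsub3 p a b (Suc c) k) * ?D = num3 (real p) (int a) (int b) (int (Suc c)) (int k)"
    if "a \<le> b" "b \<le> c" "k \<le> Suc (a + b + Suc c)" for a b
  proof (cases "k \<le> a + b + Suc c")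
    case True
    then show ?thesis
      using nsub3_Suc_closed[OF assms(1), of a b c k] num3_Suc_1[OF q, of "int a" "int b" "int c" "int k"]
        Suc.IH[of a b] that unfolding S by simp
  qed (use that top[of a b "Suc c"] in simp)
  have 2: "real (nsub3 p a (Suc c) (Suc c) k) * ?D = num3 (real p) (int a) (int (Suc c)) (int (Suc c)) (int k)"
    if "a \<le> c" "k \<le> Suc (a + Suc c + Suc c)" for a
  proof (cases "k \<le> a + Suc c + Suc c")
    case True
    then show ?thesis
      using nsub3_Suc_closed[OF assms(1), of a "Suc c" c k] num3_Suc_2[OF q, of "int a" "int c" "int k"]
        1[of a c] that nsub3_swap23[of p a "Suc c" c k] unfolding S by simp
  qed (use that top[of a "Suc c" "Suc c"] in simp)
  consider "b \<le> c" | "b = Suc c" "a \<le> c" | "b = Suc c" "a = Suc c" "k \<le> a + b + Suc c"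
    | "k = Suc (a + b + Suc c)"
    using Suc.prems by linarith
  then show ?case
  proof cases
    case 3
    have "nsub3 p (Suc c) (Suc c) c k = nsub3 p c (Suc c) (Suc c) k"
      using nsub3_swap23 nsub3_swap12 by metis
    then show ?thesis
      using 3(3) nsub3_Suc_closed[OF assms(1), of "Suc c" "Suc c" c k] num3_Suc_3[OF q, of "int c" "int k"]
        2[of c] unfolding 3(1,2) S by simp
  qed (use Suc.prems 1[of a b] 2[of a] top[of a b "Suc c"] in simp_all)
qed

section \<open>Passage to the index and to natural exponents\<close>

lemma num_subgroups_of_index_eq:
  assumes "group G" "order G = k * m" "0 < order G"
  shows "num_subgroups_of_index G m = num_subgroups_of_order G k"
proof -
  interpret group G by fact
  have "card (rcosets\<^bsub>G\<^esub> H) = m \<longleftrightarrow> card H = k" if "subgroup H G" for H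
  proof -
    have "card (rcosets\<^bsub>G\<^esub> H) * card H = k * m" using lagrange[OF that] assms(2) by simp
    then show ?thesis using assms by (metis mult.commute mult_cancel_left nat_0_less_mult_iff neq0_conv)
  qed
  then show ?thesis unfolding num_subgroups_of_index_def num_subgroups_of_order_def by metis
qed

context
  fixes q :: real
  assumes q: "1 < q"
begin

lemma fA_nat: "fA q (int k) = q ^ (2 * k + 3) - q ^ (k + 2) - q ^ (k + 1) + 1"
  unfolding fA_def by (simp add: ac_simps flip: power_int_of_nat)

lemma fB_nat: "fB q (int a) (int k) =
    q ^ (k + a + 3) + q ^ (k + a + 2) - q ^ (2 * a + 2) - q ^ (k + 2) - q ^ (k + 1) + 1"
  unfolding fB_def by (simp add: ac_simps flip: power_int_of_nat)

lemma fC_nat: "fC q (int a) (int b) (int k) =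
    (real k - real b + 1) * q ^ (b + a + 3) + q ^ (b + a + 2) - (real k - real b) * q ^ (a + b + 1)
     - q ^ (2 * a + 2) - q ^ (k + 2) - q ^ (k + 1) + 1"
  unfolding fC_def by (simp add: ac_simps flip: power_int_of_nat)

lemma fD_nat: "fD q (int a) (int b) =
    (real a + 1) * q ^ (b + a + 3) + q ^ (b + a + 2) - real a * q ^ (a + b + 1)
     - q ^ (2 * a + 2) - q ^ (a + b + 2) - q ^ (a + b + 1) + 1"
  unfolding fD_def by (simp add: ac_simps flip: power_int_of_nat)

lemma fE_nat: "fE q (int a) (int b) (int c) (int k) (int d) =
    (real c - real b + 1) * q ^ (b + a + 3) + 2 * q ^ (b + a + 2) - (real c - real b - 1) * q ^ (b + a + 1)
     - q ^ (d + 2) - q ^ (d + 1) - q ^ (2 * a + 2) - q ^ (k + 2) - q ^ (k + 1) + 1"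
  unfolding fE_def by (simp add: ac_simps flip: power_int_of_nat)

end

theorem theorem2p1:
  fixes p a1 a2 a3 b :: nat and q h :: real
  assumes "prime p" and "1 \<le> a1" and "a1 \<le> a2" and "a2 \<le> a3" and "b \<le> a1 + a2 + a3"
    and q_def: "q = real p" and h_def: "h = real (hsub a3 a2 a1 p b)"
  shows "hsub a3 a2 a1 p b = num_subgroups_of_index (rank3_group p a1 a2 a3) (p ^ (a1 + a2 + a3 - b))
    \<and> hsub a3 a2 a1 p b = hsub a3 a2 a1 p (a1 + a2 + a3 - b)
    \<and> (b \<le> a1 \<longrightarrow>
          h = (q ^ (2 * b + 3) - q ^ (b + 2) - q ^ (b + 1) + 1) / ((q - 1) * (q ^ 2 - 1)))
    \<and> (a1 \<le> b \<and> b \<le> a2 \<longrightarrow>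
          h = (q ^ (b + a1 + 3) + q ^ (b + a1 + 2) - q ^ (2 * a1 + 2) - q ^ (b + 2) - q ^ (b + 1) + 1) / ((q - 1) * (q ^ 2 - 1)))
    \<and> (a2 < b \<and> b \<le> a3 \<and> a3 \<le> a1 + a2 \<longrightarrow>
          h = ((real b - real a2 + 1) * q ^ (a2 + a1 + 3) + q ^ (a2 + a1 + 2)
             - (real b - real a2) * q ^ (a1 + a2 + 1) - q ^ (2 * a1 + 2) - q ^ (b + 2) - q ^ (b + 1) + 1) / ((q - 1) * (q ^ 2 - 1)))
    \<and> (a2 < b \<and> b \<le> a1 + a2 \<and> a1 + a2 \<le> a3 \<longrightarrow>
          h = ((real b - real a2 + 1) * q ^ (a2 + a1 + 3) + q ^ (a2 + a1 + 2)
             - (real b - real a2) * q ^ (a1 + a2 + 1) - q ^ (2 * a1 + 2) - q ^ (b + 2) - q ^ (b + 1) + 1) / ((q - 1) * (q ^ 2 - 1)))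
    \<and> (a1 + a2 \<le> b \<and> b \<le> a3 \<longrightarrow>
          h = ((real a1 + 1) * q ^ (a2 + a1 + 3) + q ^ (a2 + a1 + 2) - real a1 * q ^ (a1 + a2 + 1)
             - q ^ (2 * a1 + 2) - q ^ (a1 + a2 + 2) - q ^ (a1 + a2 + 1) + 1) / ((q - 1) * (q ^ 2 - 1)))
    \<and> (a3 < b \<and> b \<le> a1 + a2 \<longrightarrow>
          h = ((real a3 - real a2 + 1) * q ^ (a2 + a1 + 3) + 2 * q ^ (a2 + a1 + 2)
             - (real a3 - real a2 - 1) * q ^ (a2 + a1 + 1)
             - q ^ (a3 + a2 + a1 - b + 2) - q ^ (a3 + a2 + a1 - b + 1)
             - q ^ (2 * a1 + 2) - q ^ (b + 2) - q ^ (b + 1) + 1) / ((q - 1) * (q ^ 2 - 1)))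
    \<and> (a1 + a2 < a3 \<and> a3 < b \<and> b \<le> a1 + a3 \<longrightarrow>
          h = ((real a1 + real a3 - real b + 1) * q ^ (a2 + a1 + 3) + q ^ (a2 + a1 + 2)
             - (real a1 + real a3 - real b) * q ^ (a1 + a2 + 1) - q ^ (2 * a1 + 2)
             - q ^ (a1 + a2 + a3 - b + 2) - q ^ (a1 + a2 + a3 - b + 1) + 1) / ((q - 1) * (q ^ 2 - 1)))
    \<and> (a3 < a1 + a2 \<and> a1 + a2 < b \<and> b \<le> a1 + a3 \<longrightarrow>
          h = ((real a1 + real a3 - real b + 1) * q ^ (a2 + a1 + 3) + q ^ (a2 + a1 + 2)
             - (real a1 + real a3 - real b) * q ^ (a1 + a2 + 1) - q ^ (2 * a1 + 2)
             - q ^ (a1 + a2 + a3 - b + 2) - q ^ (a1 + a2 + a3 - b + 1) + 1) / ((q - 1) * (q ^ 2 - 1)))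
    \<and> (a1 + a3 \<le> b \<and> b \<le> a2 + a3 \<longrightarrow>
          h = (q ^ (2 * a1 + a2 + a3 - b + 3) + q ^ (2 * a1 + a2 + a3 - b + 2) - q ^ (2 * a1 + 2)
             - q ^ (a1 + a2 + a3 - b + 2) - q ^ (a1 + a2 + a3 - b + 1) + 1) / ((q - 1) * (q ^ 2 - 1)))
    \<and> (a2 + a3 \<le> b \<and> b \<le> a1 + a2 + a3 \<longrightarrow>
          h = (q ^ (2 * a1 + 2 * a2 + 2 * a3 - 2 * b + 3)
             - q ^ (a1 + a2 + a3 - b + 2) - q ^ (a1 + a2 + a3 - b + 1) + 1) / ((q - 1) * (q ^ 2 - 1)))"
proof -
  note p = assms(1) and a12 = assms(3) and a23 = assms(4) and b = assms(5)
  let ?D = "(q - 1) * (q ^ 2 - 1)"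
  have q: "1 < q" using prime_gt_1_nat[OF p] by (simp add: q_def)
  then have "0 < ?D" using one_less_power[of q 2] by (intro mult_pos_pos) linarith+
  then have D: "?D \<noteq> 0" by linarith
  define d where "d = a1 + a2 + a3 - b"
  have d: "int a1 + int a2 + int a3 - int b = int d" using b by (simp add: d_def)
  have G: "group (rank3_group p a1 a2 a3)" by (simp add: DirProd_group rank3_group_def)
  have order: "order (rank3_group p a1 a2 a3) = p ^ b * p ^ d"
    using b by (simp add: order_def rank3_group_def carrier_cyc[OF p] nat_power_eq card_cartesian_product
        d_def add.assoc flip: power_add)
  have index: "hsub a3 a2 a1 p b = num_subgroups_of_index (rank3_group p a1 a2 a3) (p ^ d)"
    unfolding hsub_def using prime_gt_0_nat[OF p]
    by (intro num_subgroups_of_index_eq[symmetric, OF G order]) (simp add: order)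
  have closed: "real (hsub a3 a2 a1 p k) * ?D = num3 q a1 a2 a3 k" if "k \<le> a1 + a2 + a3" for k
    unfolding hsub_eq_nsub3 q_def by (rule nsub3_closed) (use p a12 a23 that in simp_all)
  have sym: "hsub a3 a2 a1 p b = hsub a3 a2 a1 p d"
  proof -
    have "num3 q a1 a2 a3 d = num3 q a1 a2 a3 b"
      using num3_sym[OF q, of a1 a2 a3 b] a12 a23 unfolding d by simp
    then have "real (hsub a3 a2 a1 p d) * ?D = real (hsub a3 a2 a1 p b) * ?D"
      using closed[of b] closed[of d] b by (simp add: d_def)
    then show ?thesis using D by simp
  qed
  have h: "h = N / ?D" if "num3 q a1 a2 a3 b = N" for N
    using closed[OF b] D that by (simp add: h_def field_simps)
  have 1: "num3 q a1 a2 a3 b = fA q (int b)" if "b \<le> a1"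
    by (rule num3_A[OF q]) (use that in simp)
  have 2: "num3 q a1 a2 a3 b = fB q (int a1) (int b)" if "a1 \<le> b" "b \<le> a2"
    by (rule num3_B[OF q]) (use that in simp_all)
  \<comment> \<open>Serves Cases 3 and 4, whose formulas coincide.\<close>
  have 3: "num3 q a1 a2 a3 b = fC q (int a1) (int a2) (int b)" if "a2 < b" "b \<le> a3" "b \<le> a1 + a2"
    by (rule num3_C[OF q]) (use that a12 in simp_all)
  have 5: "num3 q a1 a2 a3 b = fD q (int a1) (int a2)" if "a1 + a2 \<le> b" "b \<le> a3"
    by (rule num3_D[OF q]) (use that a12 in simp_all)
  have 6: "num3 q a1 a2 a3 b = fE q (int a1) (int a2) (int a3) (int b) (int d)"
    if "a3 < b" "b \<le> a1 + a2"
    unfolding d[symmetric] by (rule num3_E[OF q]) (use that a12 a23 in simp_all)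
  \<comment> \<open>Serves Cases 7 and 8: the range starts at the larger of \<open>a3\<close> and
    \<open>a1 + a2\<close>.\<close>
  have 7: "num3 q a1 a2 a3 b = fC q (int a1) (int a2) (int d)"
    if "a3 \<le> b" "a1 + a2 \<le> b" "b \<le> a1 + a3"
    unfolding d[symmetric] by (rule num3_C'[OF q]) (use that a12 a23 in simp_all)
  have 9: "num3 q a1 a2 a3 b = fB q (int a1) (int d)" if "a1 + a3 \<le> b" "b \<le> a2 + a3"
    unfolding d[symmetric] by (rule num3_B'_closed[OF q]) (use that a12 a23 in simp_all)
  have 10: "num3 q a1 a2 a3 b = fA q (int d)" if "a2 + a3 \<le> b"
    unfolding d[symmetric] by (rule num3_A'_closed[OF q]) (use that a12 a23 in simp_all)
  \<comment> \<open>The exponents and coefficients of the statement in terms of \<open>d\<close>;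
    \<open>b \<le> a1 + a2 + a3\<close> makes the truncated subtractions exact.\<close>
  have d': "a3 + a2 + a1 - b = d" "2 * a1 + a2 + a3 - b = d + a1"
    "2 * a1 + 2 * a2 + 2 * a3 - 2 * b = 2 * d" "real a1 + real a3 - real b = real d - real a2"
    using b by (simp_all add: d_def)
  show ?thesis
    unfolding d_def[symmetric] d'
    apply (intro conjI impI; (rule index sym | rule h))
    subgoal using 1 by (simp add: fA_nat[OF q])
    subgoal using 2 by (simp add: fB_nat[OF q])
    subgoal using 3 by (simp add: fC_nat[OF q])
    subgoal using 3 by (simp add: fC_nat[OF q])
    subgoal using 5 by (simp add: fD_nat[OF q])
    subgoal using 6 by (simp add: fE_nat[OF q])
    subgoal using 7 by (simp add: fC_nat[OF q])
    subgoal using 7 by (simp add: fC_nat[OF q])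
    subgoal using 9 by (simp add: fB_nat[OF q])
    subgoal using 10 by (simp add: fA_nat[OF q])
    done
qed

end
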